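(* Let $n\ge 2$ and let $\mathcal{A}$ be a third order $n$-dimensional strongly completely positive tensor of the form $\mathcal{A}=\sum_{l=1}^r(\mathbf{u}^{(l)})^3$, where $r\ge n$, the vectors $\mathbf{u}^{(1)},\dots,\mathbf{u}^{(r)}$ span $\mathbb{R}^n$, and all of $\mathbf{u}^{(1)},\dots,\mathbf{u}^{(r)}$ are positive vectors (every component strictly positive). Then $\mathcal{A}$ is a third order positive definite symmetric tensor.
   Context: For $\mathbf{u}=(u_1,\dots,u_n)^\top\in\mathbb{R}^n$, $\mathbf{u}^3$ denotes the third order tensor $(u_iu_ju_k)$. A third order tensor $\mathcal{A}$ is strongly completely positive if $\mathcal{A}=\sum_{l=1}^r(\mathbf{u}^{(l)})^3$ for some $r\ge n$ and nonnegative vectors $\mathbf{u}^{(1)},\dots,\mathbf{u}^{(r)}$ that span $\mathbb{R}^n$. A third order $n$-dimensional complex tensor $\mathcal{A}=(a_{ijk})$ is Hermitian if $a_{ijk}=a_{jki}=a_{kij}=a_{jik}^*=a_{ikj}^*=a_{kji}^*$ for all $i,j,k$ ($^*$ is complex conjugation). For Hermitian $\mathcal{A}$ define $F:\mathbb{C}^n\to\mathbb{R}^n$ by $F(x)=y$ with $y_i=\sum_{j,k=1}^n a_{ijk}x_j^*x_k$. A Hermitian $\mathcal{A}$ is positive definite if all components of $F(x)$ are strictly positive for every nonzero $x\in\mathbb{C}^n$. A third order positive definite symmetric tensor is a positive definite Hermitian tensor all of whose entries are real. *)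

theory Defs
  imports "HOL-Analysis.Analysis"
begin

text \<open>The entry $a_{ijk}$ of a third order tensor \<open>A\<close> is \<open>A $ i $ j $ k\<close>; the dimension is
  \<open>CARD('n)\<close>.\<close>

type_synonym ('a, 'n) tensor3 = "(('a, 'n) vec, 'n) vec ^ 'n"

definition vec_cube :: "real ^ 'n \<Rightarrow> (real, 'n::finite) tensor3" where
  "vec_cube u = (\<chi> i j k. u $ i * u $ j * u $ k)"

definition strongly_completely_positive :: "(real, 'n::finite) tensor3 \<Rightarrow> bool" where
  "strongly_completely_positive A \<longleftrightarrow>
     (\<exists>(r::nat) u :: nat \<Rightarrow> real ^ 'n.
        r \<ge> CARD('n) \<and>
        (\<forall>l\<in>{1..r}. \<forall>i. u l $ i \<ge> 0) \<and>
        span (u ` {1..r}) = UNIV \<and>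
        A = (\<Sum>l=1..r. vec_cube (u l)))"

definition hermitian_tensor :: "(complex, 'n::finite) tensor3 \<Rightarrow> bool" where
  "hermitian_tensor A \<longleftrightarrow>
     (\<forall>i j k. A $ i $ j $ k = A $ j $ k $ i \<and>
              A $ i $ j $ k = A $ k $ i $ j \<and>
              A $ i $ j $ k = cnj (A $ j $ i $ k) \<and>
              A $ i $ j $ k = cnj (A $ i $ k $ j) \<and>
              A $ i $ j $ k = cnj (A $ k $ j $ i))"

text \<open>The map $F : \mathbf{C}^n \to \mathbf{R}^n$ of a Hermitian tensor. \<open>Re\<close> serves only to make
  the values real vectors: by \<open>of_real_tensor_map\<close>, nothing is discarded when \<open>A\<close> is Hermitian.\<close>

definition tensor_map :: "(complex, 'n::finite) tensor3 \<Rightarrow> complex ^ 'n \<Rightarrow> real ^ 'n" where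
  "tensor_map A x = (\<chi> i. Re (\<Sum>j\<in>UNIV. \<Sum>k\<in>UNIV. A $ i $ j $ k * cnj (x $ j) * x $ k))"

lemma of_real_tensor_map:
  assumes "hermitian_tensor A"
  shows "complex_of_real (tensor_map A x $ i) =
           (\<Sum>j\<in>UNIV. \<Sum>k\<in>UNIV. A $ i $ j $ k * cnj (x $ j) * x $ k)"
    (is "_ = ?S")
proof -
  have A: "cnj (A $ i $ j $ k) = A $ i $ k $ j" for j k
    using assms unfolding hermitian_tensor_def by metis
  have "cnj ?S = (\<Sum>j\<in>UNIV. \<Sum>k\<in>UNIV. A $ i $ k $ j * cnj (x $ k) * x $ j)"
    by (simp add: cnj_sum A mult_ac)
  also have "\<dots> = ?S"
    by (rule sum.swap)
  finally have "?S \<in> \<real>"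
    by (simp add: Reals_cnj_iff)
  then show ?thesis
    unfolding tensor_map_def vec_lambda_beta by (rule of_real_Re)
qed

definition positive_definite_tensor :: "(complex, 'n::finite) tensor3 \<Rightarrow> bool" where
  "positive_definite_tensor A \<longleftrightarrow>
     hermitian_tensor A \<and> (\<forall>x. x \<noteq> 0 \<longrightarrow> (\<forall>i. tensor_map A x $ i > 0))"

definition positive_definite_symmetric_tensor :: "(complex, 'n::finite) tensor3 \<Rightarrow> bool" where
  "positive_definite_symmetric_tensor A \<longleftrightarrow>
     positive_definite_tensor A \<and> (\<forall>i j k. A $ i $ j $ k \<in> \<real>)"

definition complex_of_real_tensor :: "(real, 'n::finite) tensor3 \<Rightarrow> (complex, 'n) tensor3" where
  "complex_of_real_tensor A = (\<chi> i j k. complex_of_real (A $ i $ j $ k))"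

end

theory Submission
  imports Defs
begin

text \<open>For \<open>A = (\<Sum>l=1..r. vec_cube (u l))\<close> and \<open>x = y + \<i>z\<close> with \<open>y\<close>, \<open>z\<close> real, the \<open>i\<close>-th
  component of \<open>F(x)\<close> is \<open>\<Sum>l=1..r. u l $ i * ((u l \<bullet> y)\<^sup>2 + (u l \<bullet> z)\<^sup>2)\<close>. All weights
  \<open>u l $ i\<close> are positive, so it can only vanish if \<open>y\<close> and \<open>z\<close> are orthogonal to every \<open>u l\<close>, hence
  to the whole space.\<close>

lemma vec_cube_nth: "vec_cube u $ i $ j $ k = u $ i * u $ j * u $ k"
  by (simp add: vec_cube_def)

text \<open>The entries are real and invariant under all permutations of the indices, so conjugation
  changes nothing.\<close>

lemma hermitian_complex_of_real_sum_vec_cube: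
  "hermitian_tensor (complex_of_real_tensor (\<Sum>l\<in>L. vec_cube (u l)))"
  unfolding hermitian_tensor_def complex_of_real_tensor_def
  by (simp add: vec_cube_nth mult_ac)

text \<open>In each cube the dependence on \<open>j\<close> and \<open>k\<close> factors, so once
  the sum over \<open>l\<close> is moved outside, the double sum is a product of two equal inner
  products.\<close>

lemma sum_vec_cube_quadratic_form:
  fixes u :: "'l \<Rightarrow> real ^ 'n::finite"
  shows "(\<Sum>j\<in>UNIV. \<Sum>k\<in>UNIV. (\<Sum>l\<in>L. vec_cube (u l)) $ i $ j $ k * (y $ j * y $ k)) =
    (\<Sum>l\<in>L. u l $ i * (u l \<bullet> y)\<^sup>2)"
proof -
  have "(\<Sum>j\<in>UNIV. \<Sum>k\<in>UNIV. (\<Sum>l\<in>L. vec_cube (u l)) $ i $ j $ k * (y $ j * y $ k)) =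
      (\<Sum>j\<in>UNIV. \<Sum>k\<in>UNIV. \<Sum>l\<in>L. u l $ i * (u l $ j * y $ j * (u l $ k * y $ k)))"
    by (simp add: vec_cube_nth sum_distrib_left mult_ac)
  also have "\<dots> = (\<Sum>j\<in>UNIV. \<Sum>l\<in>L. \<Sum>k\<in>UNIV. u l $ i * (u l $ j * y $ j * (u l $ k * y $ k)))"
    by (intro sum.cong refl sum.swap)
  also have "\<dots> = (\<Sum>l\<in>L. \<Sum>j\<in>UNIV. \<Sum>k\<in>UNIV. u l $ i * (u l $ j * y $ j * (u l $ k * y $ k)))"
    by (rule sum.swap)
  also have "\<dots> = (\<Sum>l\<in>L. u l $ i * (u l \<bullet> y)\<^sup>2)"
    by (simp add: inner_vec_def power2_eq_square sum_product flip: sum_distrib_left)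
  finally show ?thesis .
qed

lemma tensor_map_complex_of_real_sum_vec_cube:
  fixes u :: "'l \<Rightarrow> real ^ 'n::finite"
  shows "tensor_map (complex_of_real_tensor (\<Sum>l\<in>L. vec_cube (u l))) x $ i =
    (\<Sum>l\<in>L. u l $ i * ((u l \<bullet> (\<chi> j. Re (x $ j)))\<^sup>2 + (u l \<bullet> (\<chi> j. Im (x $ j)))\<^sup>2))"
proof -
  let ?A = "\<Sum>l\<in>L. vec_cube (u l)"
  let ?y = "\<chi> j. Re (x $ j)" and ?z = "\<chi> j. Im (x $ j)"
  \<comment> \<open>With a real coefficient, the cross terms of \<open>cnj v * w\<close> are purely
    imaginary; the form therefore splits into one real form in \<open>?y\<close> and one in
    \<open>?z\<close>.\<close>
  have Re_summand: "Re (of_real a * cnj v * w) = a * (Re v * Re w) + a * (Im v * Im w)" for a v w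
    by (simp add: algebra_simps)
  have "tensor_map (complex_of_real_tensor ?A) x $ i =
      (\<Sum>j\<in>UNIV. \<Sum>k\<in>UNIV. ?A $ i $ j $ k * (?y $ j * ?y $ k)) +
      (\<Sum>j\<in>UNIV. \<Sum>k\<in>UNIV. ?A $ i $ j $ k * (?z $ j * ?z $ k))"
    unfolding tensor_map_def complex_of_real_tensor_def vec_lambda_beta Re_sum Re_summand
    by (simp only: sum.distrib)
  then show ?thesis
    unfolding sum_vec_cube_quadratic_form by (simp only: distrib_left sum.distrib)
qed

text \<open>A vector orthogonal to \<open>S\<close> is orthogonal to \<open>span S\<close>, which
  here contains the vector itself.\<close>

lemma exists_inner_nonzero_of_span_UNIV:
  fixes S :: "'a::real_inner set"
  assumes "span S = UNIV" and "y \<noteq> 0"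
  shows "\<exists>s\<in>S. s \<bullet> y \<noteq> 0"
proof (rule ccontr)
  assume "\<not> ?thesis"
  then have "orthogonal y s" if "s \<in> S" for s
    using that by (simp add: orthogonal_def inner_commute)
  then have "orthogonal y y"
    using assms(1) orthogonal_to_span by blast
  with \<open>y \<noteq> 0\<close> show False
    by (simp add: orthogonal_self)
qed

theorem corollary3p4:
  fixes A :: "(real, 'n::finite) tensor3"
    and r :: nat
    and u :: "nat \<Rightarrow> real ^ 'n"
  assumes "CARD('n) \<ge> 2"
    and "strongly_completely_positive A"
    and "A = (\<Sum>l=1..r. vec_cube (u l))"
    and "r \<ge> CARD('n)"
    and "span (u ` {1..r}) = UNIV"
    and "\<And>l i. l \<in> {1..r} \<Longrightarrow> u l $ i > 0"
  shows "positive_definite_symmetric_tensor (complex_of_real_tensor A)"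
proof -
  have "tensor_map (complex_of_real_tensor A) x $ i > 0" if "x \<noteq> 0" for x i
  proof -
    let ?y = "\<chi> j. Re (x $ j)" and ?z = "\<chi> j. Im (x $ j)"
    have "?y \<noteq> 0 \<or> ?z \<noteq> 0"
      using that by (auto simp: vec_eq_iff complex_eq_iff)
    then obtain l where l: "l \<in> {1..r}" "u l \<bullet> ?y \<noteq> 0 \<or> u l \<bullet> ?z \<noteq> 0"
      using exists_inner_nonzero_of_span_UNIV[OF assms(5)] by blast
    then have "(u l \<bullet> ?y)\<^sup>2 + (u l \<bullet> ?z)\<^sup>2 > 0"
      by (simp add: sum_power2_gt_zero_iff)
    \<comment> \<open>The summand at the chosen \<open>l\<close> is strictly positive and the others
      are nonnegative. The choice of \<open>l\<close> depends only on \<open>x\<close>; strict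
      positivity of \<open>u l $ i\<close> makes it serve every component \<open>i\<close>.\<close>
    with l(1) have "(\<Sum>l=1..r. u l $ i * ((u l \<bullet> ?y)\<^sup>2 + (u l \<bullet> ?z)\<^sup>2)) > 0"
      using assms(6) by (intro sum_pos2[where i = l]) (auto simp: less_imp_le)
    then show ?thesis
      unfolding assms(3) tensor_map_complex_of_real_sum_vec_cube .
  qed
  moreover have "hermitian_tensor (complex_of_real_tensor A)"
    unfolding assms(3) by (rule hermitian_complex_of_real_sum_vec_cube)
  ultimately show ?thesis
    unfolding positive_definite_symmetric_tensor_def positive_definite_tensor_def
    by (simp add: complex_of_real_tensor_def)
qed

end
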